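(* Let $d\ge1$, $\mu\in\mathbb{R}^d$, $A$ a $d\times d$ symmetric positive definite matrix and $R$ a $d\times d$ reflection nonsingular $\mathcal{M}$-matrix. Fix a nonempty subset $I\subseteq\{1,\dots,d\}$. If $\mathrm{SRBM}^{|I|}([R]_I,[\mu]_I,[A]_I)$ hits the corner, then $\mathrm{SRBM}^d(R,\mu,A)$ hits the edge $S_I$.
   Context: For $I=\{i_1<\dots<i_m\}$: $[x]_I=(x_{i_1},\dots,x_{i_m})'$, $[C]_I=(c_{i_ki_l})_{k,l}$. $S=\mathbb{R}^d_+$, $S_I=\{x\in S:x_i=0\ \forall i\in I\}$. Reflection nonsingular $\mathcal{M}$-matrix: $r_{ii}=1$, $r_{ij}\le0$ ($i\ne j$), spectral radius of $I_d-R$ less than $1$. $\mathrm{SRBM}^d(R,\mu,A)$ started at $z\in S$: continuous adapted $S$-valued $Z=B+RL$, with $B$ a Brownian motion with drift $\mu$, covariance $A$, $B(0)=z$, and $L=(L_1,\dots,L_d)'$ continuous adapted, each $L_k$ nondecreasing, $L_k(0)=0$, $\int_0^\infty Z_k\,dL_k=0$ (exists and pathwise unique for all $z$). It hits $S_I$ if $\mathbb{P}_z(\exists t>0: Z(t)\in S_I)>0$ for every $z\in S$; hitting the corner means hitting $\{0\}$. *)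

theory Defs
  imports "HOL-Probability.Probability"
begin

text \<open>Conventions. Coordinates are 0-based: R^m is represented by functions
 nat => real of which only the coordinates k < m matter; m x m matrices by
 nat => nat => real with indices < m. Time is real, only t >= 0 matters.
 A process is X :: real => 'a => (nat => real).\<close>

definition sub_vec :: "nat set \<Rightarrow> (nat \<Rightarrow> real) \<Rightarrow> (nat \<Rightarrow> real)" where
  "sub_vec I x = (\<lambda>k. x (sorted_list_of_set I ! k))"

definition sub_mat :: "nat set \<Rightarrow> (nat \<Rightarrow> nat \<Rightarrow> real) \<Rightarrow> (nat \<Rightarrow> nat \<Rightarrow> real)" where
  "sub_mat I C = (\<lambda>k l. C (sorted_list_of_set I ! k) (sorted_list_of_set I ! l))"

definition is_eigenvalue :: "nat \<Rightarrow> (nat \<Rightarrow> nat \<Rightarrow> real) \<Rightarrow> complex \<Rightarrow> bool" where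
  "is_eigenvalue m C lam \<longleftrightarrow> (\<exists>v::nat \<Rightarrow> complex. (\<exists>i<m. v i \<noteq> 0) \<and>
      (\<forall>i<m. (\<Sum>j<m. complex_of_real (C i j) * v j) = lam * v i))"

definition spectral_radius_lt_one :: "nat \<Rightarrow> (nat \<Rightarrow> nat \<Rightarrow> real) \<Rightarrow> bool" where
  "spectral_radius_lt_one m C \<longleftrightarrow> (\<forall>lam. is_eigenvalue m C lam \<longrightarrow> cmod lam < 1)"

definition reflection_M_matrix :: "nat \<Rightarrow> (nat \<Rightarrow> nat \<Rightarrow> real) \<Rightarrow> bool" where
  "reflection_M_matrix m R \<longleftrightarrow> (\<forall>i<m. R i i = 1) \<and> (\<forall>i<m. \<forall>j<m. i \<noteq> j \<longrightarrow> R i j \<le> 0)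
     \<and> spectral_radius_lt_one m (\<lambda>i j. (if i = j then 1 else 0) - R i j)"

definition sym_pos_def :: "nat \<Rightarrow> (nat \<Rightarrow> nat \<Rightarrow> real) \<Rightarrow> bool" where
  "sym_pos_def m A \<longleftrightarrow> (\<forall>i<m. \<forall>j<m. A i j = A j i) \<and>
     (\<forall>u. (\<exists>i<m. u i \<noteq> 0) \<longrightarrow> (\<Sum>i<m. \<Sum>j<m. u i * A i j * u j) > 0)"

definition gauss :: "real \<Rightarrow> real \<Rightarrow> real measure" where
  "gauss a v = (if v > 0 then density lborel (normal_density a (sqrt v)) else return lborel a)"

definition filtered_prob :: "'a measure \<Rightarrow> (real \<Rightarrow> 'a measure) \<Rightarrow> bool" where
  "filtered_prob M F \<longleftrightarrow> prob_space M \<and> filtration (space M) F \<and> (\<forall>t. sets (F t) \<subseteq> sets M)"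

definition adapted_cont :: "'a measure \<Rightarrow> (real \<Rightarrow> 'a measure) \<Rightarrow> nat \<Rightarrow> (real \<Rightarrow> 'a \<Rightarrow> nat \<Rightarrow> real) \<Rightarrow> bool" where
  "adapted_cont M F m X \<longleftrightarrow>
     (\<forall>t\<ge>0. \<forall>k<m. (\<lambda>\<omega>. X t \<omega> k) \<in> borel_measurable (F t)) \<and>
     (\<forall>\<omega>\<in>space M. \<forall>k<m. continuous_on {0..} (\<lambda>t. X t \<omega> k))"

text \<open>m-dimensional (F_t)-Brownian motion with drift mu, covariance A, B(0) = z:
 continuous, adapted, and for 0 <= s < t the increment B(t) - B(s) is independent of
 F_s and Gaussian with mean (t-s) mu and covariance (t-s) A; the joint Gaussian law
 is expressed through all linear combinations (Cramer-Wold).\<close>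
definition brownian :: "'a measure \<Rightarrow> (real \<Rightarrow> 'a measure) \<Rightarrow> nat \<Rightarrow> (nat \<Rightarrow> real) \<Rightarrow>
    (nat \<Rightarrow> nat \<Rightarrow> real) \<Rightarrow> (nat \<Rightarrow> real) \<Rightarrow> (real \<Rightarrow> 'a \<Rightarrow> nat \<Rightarrow> real) \<Rightarrow> bool" where
  "brownian M F m \<mu> A z B \<longleftrightarrow> filtered_prob M F \<and> adapted_cont M F m B \<and>
     (\<forall>\<omega>\<in>space M. \<forall>k<m. B 0 \<omega> k = z k) \<and>
     (\<forall>s t. 0 \<le> s \<longrightarrow> s < t \<longrightarrow> (\<forall>u::nat \<Rightarrow> real. \<forall>E\<in>sets (F s). \<forall>C\<in>sets borel.
        measure M (E \<inter> {\<omega>\<in>space M. (\<Sum>k<m. u k * (B t \<omega> k - B s \<omega> k)) \<in> C}) =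
        measure M E * measure (gauss ((t - s) * (\<Sum>k<m. u k * \<mu> k))
                                     ((t - s) * (\<Sum>i<m. \<Sum>j<m. u i * A i j * u j))) C))"

definition is_srbm :: "'a measure \<Rightarrow> (real \<Rightarrow> 'a measure) \<Rightarrow> nat \<Rightarrow> (nat \<Rightarrow> nat \<Rightarrow> real) \<Rightarrow>
    (nat \<Rightarrow> real) \<Rightarrow> (nat \<Rightarrow> nat \<Rightarrow> real) \<Rightarrow> (nat \<Rightarrow> real) \<Rightarrow> (real \<Rightarrow> 'a \<Rightarrow> nat \<Rightarrow> real) \<Rightarrow> bool" where
  "is_srbm M F m R \<mu> A z Z \<longleftrightarrow> (\<exists>B L.
     brownian M F m \<mu> A z B \<and> adapted_cont M F m Z \<and> adapted_cont M F m L \<and>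
     (\<forall>\<omega>\<in>space M. \<forall>t\<ge>0. \<forall>k<m. Z t \<omega> k = B t \<omega> k + (\<Sum>j<m. R k j * L t \<omega> j)) \<and>
     (\<forall>\<omega>\<in>space M. \<forall>t\<ge>0. \<forall>k<m. Z t \<omega> k \<ge> 0) \<and>
     (\<forall>\<omega>\<in>space M. \<forall>k<m. L 0 \<omega> k = 0 \<and> mono_on {0..} (\<lambda>t. L t \<omega> k) \<and>
        (\<integral>\<^sup>+ t\<in>{0..}. ennreal (Z t \<omega> k) \<partial>(interval_measure (\<lambda>t. L (max t 0) \<omega> k))) = 0))"

text \<open>SRBM^m(R, mu, A) hits the set {x in S : x_i = 0 for i in J}: for every
 starting point z in S, on every filtered probability space (sample space of type 'a)
 and for every SRBM started at z, the hitting event has positive (outer) probability,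
 i.e. it is not almost surely avoided.\<close>
definition srbm_hits :: "'a itself \<Rightarrow> nat \<Rightarrow> (nat \<Rightarrow> nat \<Rightarrow> real) \<Rightarrow> (nat \<Rightarrow> real) \<Rightarrow>
    (nat \<Rightarrow> nat \<Rightarrow> real) \<Rightarrow> nat set \<Rightarrow> bool" where
  "srbm_hits (_::'a itself) m R \<mu> A J \<longleftrightarrow>
     (\<forall>z. (\<forall>k<m. z k \<ge> 0) \<longrightarrow>
       (\<forall>(M::'a measure) F Z. is_srbm M F m R \<mu> A z Z \<longrightarrow>
          \<not> (AE \<omega> in M. \<forall>t>0. \<not> (\<forall>k\<in>J. Z t \<omega> k = 0))))"

end

theory Submission
  imports Defs
begin

text \<open>Let \<open>Z = B + R L\<close>. On the same probability space, reflect the subvector \<open>[B]\<^sub>I\<close> with the matrix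
  \<open>[R]\<^sub>I\<close>, obtaining \<open>Z'\<close>. Since the off-diagonal entries of \<open>R\<close> are nonpositive, the vector \<open>[Z]\<^sub>I\<close> is
  the reflection of \<open>[B]\<^sub>I\<close> minus a componentwise nondecreasing process, and the comparison principle
  for the Skorokhod problem gives \<open>[Z]\<^sub>I \<le> Z'\<close>. So \<open>Z\<close> is on the edge whenever \<open>Z'\<close> is at the
  corner. The comparison is obtained along the Picard iteration defining \<open>Z'\<close>: by induction,
  \<open>[L]\<^sub>I\<close> minus each iterate is nondecreasing in time.\<close>

section \<open>One-dimensional Skorokhod reflection at zero\<close>

text \<open>The classical explicit Skorokhod map: \<open>y + regulator y\<close> is the path
  \<open>y\<close> reflected at zero. The real-valued \<open>SUP\<close> is informative only for
  images bounded above, hence the \<open>bdd_above\<close> hypotheses below.\<close>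

definition regulator :: "(real \<Rightarrow> real) \<Rightarrow> real \<Rightarrow> real" where
  "regulator y t = (SUP s\<in>{0..t}. max 0 (- y s))"

lemma regulator_upper:
  assumes "bdd_above ((\<lambda>s. max 0 (- y s)) ` {0..t})" "0 \<le> s" "s \<le> t"
  shows "0 \<le> regulator y t" "- y s \<le> regulator y t"
proof -
  have *: "max 0 (- y s) \<le> regulator y t"
    unfolding regulator_def using assms by (intro cSUP_upper) auto
  then show "0 \<le> regulator y t" "- y s \<le> regulator y t" by auto
qed

lemma regulator_least:
  assumes "0 \<le> t" "0 \<le> c" "\<And>s. 0 \<le> s \<Longrightarrow> s \<le> t \<Longrightarrow> - y s \<le> c"
  shows "regulator y t \<le> c"
  unfolding regulator_def using assms by (intro cSUP_least) auto

lemma regulator_mono_on: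
  assumes "\<And>t. 0 \<le> t \<Longrightarrow> bdd_above ((\<lambda>s. max 0 (- y s)) ` {0..t})"
  shows "mono_on {0..} (regulator y)"
proof (rule mono_onI)
  fix r s :: real assume "r \<in> {0..}" "s \<in> {0..}" "r \<le> s"
  then show "regulator y r \<le> regulator y s"
    using regulator_upper[OF assms, of s] by (intro regulator_least) auto
qed

text \<open>On \<open>{a..b}\<close> the path \<open>- y\<close> peaks at some \<open>u\<close>, so
  \<open>regulator y b\<close> is at most the maximum of \<open>regulator y a\<close> and
  \<open>- y u\<close>. Positivity of the reflected path at \<open>u\<close> gives
  \<open>- y u < regulator y b\<close>, which leaves only \<open>regulator y a\<close>.
  Complementarity of the constructed solution rests on this.\<close>

lemma regulator_flat:
  assumes cont: "continuous_on {0..} y" and ab: "0 \<le> a" "a \<le> b"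
    and pos: "\<And>t. a \<le> t \<Longrightarrow> t \<le> b \<Longrightarrow> y t + regulator y t > 0"
    and bdd: "\<And>t. 0 \<le> t \<Longrightarrow> bdd_above ((\<lambda>s. max 0 (- y s)) ` {0..t})"
  shows "regulator y b = regulator y a"
proof (rule antisym)
  have mono: "regulator y s \<le> regulator y t" if "0 \<le> s" "s \<le> t" for s t
    using that by (intro mono_onD[OF regulator_mono_on[OF bdd]]) auto
  show "regulator y a \<le> regulator y b" using mono ab by auto
  have "continuous_on {a..b} (\<lambda>t. - y t)"
    using cont by (intro continuous_intros) (rule continuous_on_subset, use ab in auto)
  from continuous_attains_sup[OF _ _ this] ab obtain u
    where u: "a \<le> u" "u \<le> b" "\<And>t. a \<le> t \<Longrightarrow> t \<le> b \<Longrightarrow> - y t \<le> - y u" by auto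
  define c where "c = max (regulator y a) (- y u)"
  have le_c: "regulator y b \<le> c"
  proof (rule regulator_least)
    show "0 \<le> b" using ab by auto
    show "0 \<le> c" unfolding c_def using regulator_upper(1)[OF bdd, of a a] ab by auto
    fix s assume s: "0 \<le> s" "s \<le> b"
    show "- y s \<le> c"
    proof (cases "s \<le> a")
      case True
      then show ?thesis unfolding c_def using regulator_upper(2)[OF bdd, of a s] ab s by auto
    next
      case False
      then show ?thesis unfolding c_def using u(3)[of s] s by auto
    qed
  qed
  have "- y u < regulator y u" using pos[of u] u by auto
  also have "\<dots> \<le> regulator y b" using mono u ab by auto
  finally show "regulator y b \<le> regulator y a" using le_c by (auto simp: c_def max_def split: if_splits)
qed

text \<open>One-dimensional comparison: \<^term>\<open>l\<close> regulates \<^term>\<open>\<lambda>t. y t - v t\<close>, and the assumption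
  \<^term>\<open>last\<close> is the complementarity condition in terms of the last visit to zero.\<close>

lemma regulator_comparison:
  fixes y v l :: "real \<Rightarrow> real"
  assumes l: "mono_on {0..} l" "l 0 = 0" and v: "mono_on {0..} v" "v 0 = 0"
    and nonneg: "\<And>t. 0 \<le> t \<Longrightarrow> 0 \<le> y t - v t + l t"
    and last: "\<And>s. 0 \<le> s \<Longrightarrow> l s = 0 \<or> (\<exists>u. 0 \<le> u \<and> u \<le> s \<and> y u - v u + l u = 0 \<and> l u = l s)"
  shows "0 \<le> t \<Longrightarrow> bdd_above ((\<lambda>s. max 0 (- y s)) ` {0..t})"
    and "0 \<le> t \<Longrightarrow> l t \<le> regulator y t + v t"
    and "mono_on {0..} (\<lambda>t. l t - regulator y t)"
proof -
  have lm: "l s \<le> l t" and vm: "v s \<le> v t" if "0 \<le> s" "s \<le> t" for s t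
    using that by (intro mono_onD[OF l(1)] mono_onD[OF v(1)]; auto)+
  have l0: "0 \<le> l t" and v0: "0 \<le> v t" if "0 \<le> t" for t
    using lm[of 0 t] vm[of 0 t] that l v by auto
  show bdd: "bdd_above ((\<lambda>s. max 0 (- y s)) ` {0..t})" if "0 \<le> t" for t
  proof (rule bdd_aboveI2)
    fix s assume s: "s \<in> {0..t}"
    then show "max 0 (- y s) \<le> l t" using nonneg[of s] lm[of s t] v0[of s] l0[of t] by auto
  qed
  show le: "l t \<le> regulator y t + v t" if t: "0 \<le> t" for t
    using last[OF t]
  proof (elim disjE exE conjE)
    assume "l t = 0"
    then show ?thesis using regulator_upper(1)[OF bdd, of t t] v0[OF t] t by auto
  next
    \<comment> \<open>The zero at \<open>u\<close> gives \<open>l t = v u - y u\<close>; then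
      \<open>v u \<le> v t\<close> and \<open>- y u \<le> regulator y t\<close>.\<close>
    fix u assume u: "0 \<le> u" "u \<le> t" "y u - v u + l u = 0" "l u = l t"
    then show ?thesis using regulator_upper(2)[OF bdd, of t u] vm[of u t] t by auto
  qed
  show "mono_on {0..} (\<lambda>t. l t - regulator y t)"
  proof (rule mono_onI)
    fix s t :: real assume "s \<in> {0..}" "t \<in> {0..}" and st: "s \<le> t"
    then have s: "0 \<le> s" and t: "0 \<le> t" by auto
    have "regulator y t \<le> regulator y s + (l t - l s)"
    proof (rule regulator_least[OF t])
      show "0 \<le> regulator y s + (l t - l s)"
        using regulator_upper(1)[OF bdd, of s s] lm[OF s st] s by auto
      fix u assume u: "0 \<le> u" "u \<le> t"
      show "- y u \<le> regulator y s + (l t - l s)"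
      proof (cases "u \<le> s")
        case True
        then show ?thesis using regulator_upper(2)[OF bdd, of s u] s u lm[OF s st] by auto
      next
        case False
        \<comment> \<open>After \<open>s\<close>, nonnegativity gives
          \<open>- y u \<le> l t - v s\<close>, and the bound \<open>le\<close> at time
          \<open>s\<close> gives \<open>- v s \<le> regulator y s - l s\<close>.\<close>
        then show ?thesis using le[OF s] nonneg[of u] lm[of u t] vm[of s u] s u by auto
      qed
    qed
    then show "l s - regulator y s \<le> l t - regulator y t" by auto
  qed
qed

section \<open>The complementarity integral in terms of zeros and flat stretches\<close>

text \<open>Take the first time \<open>u\<close> at which \<open>l\<close> reaches its value
  \<open>l s\<close>. If \<open>u > 0\<close> and \<open>z u > 0\<close>, then \<open>z\<close> is
  bounded away from zero on some interval \<open>{a<..u}\<close>, to which \<open>l\<close> gives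
  positive mass, so the integral could not vanish.\<close>

lemma last_zero_of_complementarity:
  fixes l z :: "real \<Rightarrow> real"
  assumes cl: "continuous_on {0..} l" and ml: "mono_on {0..} l" and l0: "l 0 = 0"
    and cz: "continuous_on {0..} z" and z0: "\<And>t. 0 \<le> t \<Longrightarrow> 0 \<le> z t"
    and int: "(\<integral>\<^sup>+ t\<in>{0..}. ennreal (z t) \<partial>(interval_measure (\<lambda>t. l (max t 0)))) = 0"
    and s: "0 \<le> s"
  shows "l s = 0 \<or> (\<exists>u. 0 \<le> u \<and> u \<le> s \<and> z u = 0 \<and> l u = l s)"
proof -
  define S where "S = {u\<in>{0..s}. l u = l s}"
  have "closed S" unfolding S_def
    by (intro continuous_closed_preimage_constant continuous_on_subset[OF cl]) auto
  moreover have "s \<in> S" and bdd: "bdd_below S" using s by (auto simp: S_def)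
  ultimately have "Inf S \<in> S" by (intro closed_contains_Inf) auto
  define u where "u = Inf S"
  have u: "0 \<le> u" "u \<le> s" "l u = l s" using \<open>Inf S \<in> S\<close> by (auto simp: u_def S_def)
  show ?thesis
  proof (cases "u = 0 \<or> z u = 0")
    case True
    then show ?thesis using u l0 by auto
  next
    case False
    then have up: "0 < u" and zp: "0 < z u" using u z0[of u] by auto
    obtain \<delta> where \<delta>: "\<delta> > 0" "\<And>t. 0 \<le> t \<Longrightarrow> dist t u < \<delta> \<Longrightarrow> dist (z t) (z u) < z u / 2"
      using cz u zp unfolding continuous_on_iff by (metis atLeast_iff half_gt_zero)
    \<comment> \<open>Half of \<open>\<delta>\<close> keeps all of \<open>{a<..u}\<close> within
      distance \<open>\<delta>\<close> of \<open>u\<close>; the maximum with 0 keeps it in the time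
      domain.\<close>
    define a where "a = max 0 (u - \<delta> / 2)"
    have a: "0 \<le> a" "a < u" using up \<delta> by (auto simp: a_def)
    have big: "z u / 2 \<le> z t" if "t \<in> {a<..u}" for t
    proof -
      have "dist t u < \<delta>" "0 \<le> t" using that \<delta> a by (auto simp: a_def dist_real_def)
      from \<delta>(2)[OF this(2,1)] show ?thesis by (auto simp: dist_real_def abs_if split: if_splits)
    qed
    have "a \<notin> S" using cInf_lower[OF _ bdd, of a] a by (auto simp: u_def)
    then have "l a \<noteq> l u" using a u by (auto simp: S_def)
    then have la: "l a < l u" using mono_onD[OF ml, of a u] a u by auto
    \<comment> \<open>Freezing \<open>l\<close> at \<open>l 0\<close> for negative times makes it
      monotone and continuous on the whole line, as \<open>interval_measure\<close>
      requires.\<close>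
    let ?G = "\<lambda>t. l (max t 0)"
    let ?\<nu> = "interval_measure ?G"
    have "emeasure ?\<nu> {a<..u} = ennreal (?G u - ?G a)"
    proof (rule emeasure_interval_measure_Ioc)
      show "a \<le> u" using a by auto
      show "?G x \<le> ?G y" if "x \<le> y" for x y using that by (intro mono_onD[OF ml]) auto
      have "continuous_on UNIV ?G"
        by (intro continuous_on_compose2[OF cl] continuous_intros) auto
      then show "continuous (at_right x) ?G" for x
        by (simp add: continuous_on_eq_continuous_at continuous_at_imp_continuous_within)
    qed
    then have "ennreal (z u / 2) * ennreal (l u - l a) = (\<integral>\<^sup>+ t. ennreal (z u / 2) * indicator {a<..u} t \<partial>?\<nu>)"
      using a u by (subst nn_integral_cmult_indicator) auto
    also have "\<dots> \<le> (\<integral>\<^sup>+ t\<in>{0..}. ennreal (z t) \<partial>?\<nu>)"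
      using big a by (intro nn_integral_mono) (auto simp: indicator_def intro!: ennreal_leI)
    finally have "ennreal (z u / 2) * ennreal (l u - l a) = 0" using int by auto
    then show ?thesis using zp la by (auto simp: ennreal_eq_0_iff)
  qed
qed

text \<open>The set where \<open>z\<close> is positive is covered by countably many intervals on
  which \<open>z\<close> stays positive. There \<open>l\<close> is constant, so its measure vanishes
  on each of them and on their union.\<close>

lemma complementarity_of_flat:
  fixes l z :: "real \<Rightarrow> real"
  assumes cl: "continuous_on {0..} l" and ml: "mono_on {0..} l"
    and cz: "continuous_on {0..} z" and z0: "\<And>t. 0 \<le> t \<Longrightarrow> 0 \<le> z t"
    and flat: "\<And>a b. 0 \<le> a \<Longrightarrow> a \<le> b \<Longrightarrow> (\<And>t. a \<le> t \<Longrightarrow> t \<le> b \<Longrightarrow> 0 < z t) \<Longrightarrow> l b = l a"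
  shows "(\<integral>\<^sup>+ t\<in>{0..}. ennreal (z t) \<partial>(interval_measure (\<lambda>t. l (max t 0)))) = 0"
proof -
  let ?G = "\<lambda>t. l (max t 0)"
  let ?\<nu> = "interval_measure ?G"
  let ?z = "\<lambda>t. z (max t 0)"
  have cG: "continuous_on UNIV ?G" and cz': "continuous_on UNIV ?z"
    by (intro continuous_on_compose2[OF cl] continuous_on_compose2[OF cz] continuous_intros; auto)+
  have em: "emeasure ?\<nu> {a<..b} = ennreal (?G b - ?G a)" if "a \<le> b" for a b
  proof (rule emeasure_interval_measure_Ioc[OF that])
    show "?G x \<le> ?G y" if "x \<le> y" for x y using that by (intro mono_onD[OF ml]) auto
    show "continuous (at_right x) ?G" for x
      using cG by (simp add: continuous_on_eq_continuous_at continuous_at_imp_continuous_within)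
  qed
  \<comment> \<open>Rational endpoints give countability. Using the extended path \<open>?z\<close>
    allows a negative left endpoint, so that time 0 too is interior to such an interval when
    \<open>z 0 > 0\<close>.\<close>
  define P where "P = {(a, b). a \<in> \<rat> \<and> b \<in> \<rat> \<and> a \<le> b \<and> (\<forall>t\<in>{a..b}. 0 < ?z t)}"
  have "countable P"
    by (rule countable_subset[of _ "\<rat> \<times> \<rat>"]) (auto simp: P_def countable_rat)
  have "emeasure ?\<nu> {a<..b} = 0" if "(a, b) \<in> P" for a b
  proof -
    have ab: "a \<le> b" and pos: "\<And>t. a \<le> t \<Longrightarrow> t \<le> b \<Longrightarrow> 0 < ?z t" using that by (auto simp: P_def)
    have "l (max b 0) = l (max a 0)"
    proof (rule flat)
      fix t assume "max a 0 \<le> t" "t \<le> max b 0"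
      \<comment> \<open>For \<open>b \<le> 0\<close> only \<open>t = 0\<close> occurs, and
        positivity of \<open>?z\<close> at \<open>b\<close> is positivity of
        \<open>z 0\<close>.\<close>
      then show "0 < z t" using pos[of t] pos[of b] ab by (cases "b \<le> 0") (auto simp: max_def split: if_splits)
    qed (use ab in auto)
    then show ?thesis using em[OF ab] by simp
  qed
  then have null: "(\<Union>(a, b)\<in>P. {a<..b}) \<in> null_sets ?\<nu>"
    using \<open>countable P\<close> by (intro null_sets_UN') auto
  have cover: "t \<in> (\<Union>(a, b)\<in>P. {a<..b})" if t: "0 < ?z t" for t
  proof -
    obtain \<delta> where \<delta>: "\<delta> > 0" "\<And>r. dist r t < \<delta> \<Longrightarrow> dist (?z r) (?z t) < ?z t"
      using cz' t unfolding continuous_on_iff by (metis UNIV_I)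
    obtain a where a: "a \<in> \<rat>" "t - \<delta> < a" "a < t" using Rats_dense_in_real[of "t - \<delta>" t] \<delta> by auto
    obtain b where b: "b \<in> \<rat>" "t < b" "b < t + \<delta>" using Rats_dense_in_real[of t "t + \<delta>"] \<delta> by auto
    have "0 < ?z r" if "r \<in> {a..b}" for r
    proof -
      have "dist r t < \<delta>" using that a b unfolding dist_real_def by auto
      from \<delta>(2)[OF this] show ?thesis unfolding dist_real_def by linarith
    qed
    then have "(a, b) \<in> P" using a b by (auto simp: P_def)
    then show ?thesis using a b by (intro UN_I[of "(a, b)"]) auto
  qed
  have "AE t in ?\<nu>. ennreal (z t) * indicator {0..} t = 0"
    using AE_not_in[OF null]
  proof eventually_elim
    case (elim t)
    then have "\<not> 0 < ?z t" using cover by blast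
    then show ?case by (auto simp: indicator_def max_def ennreal_eq_0_iff split: if_splits)
  qed
  then have "(\<integral>\<^sup>+ t\<in>{0..}. ennreal (z t) \<partial>?\<nu>) = (\<integral>\<^sup>+ t. 0 \<partial>?\<nu>)"
    by (rule nn_integral_cong_AE)
  then show ?thesis by simp
qed

section \<open>Continuity by domination, and measurability of the regulator\<close>

text \<open>Each increment of \<open>f\<close> is at most that of \<open>l\<close> in absolute
  value, so \<open>f\<close> inherits the modulus of continuity of \<open>l\<close>. This is how the
  iterates and their limit become continuous.\<close>

lemma continuous_on_dominated_increments:
  fixes f l :: "real \<Rightarrow> real"
  assumes f: "mono_on S f" and lf: "mono_on S (\<lambda>t. l t - f t)" and l: "continuous_on S l"
  shows "continuous_on S f"
proof -
  have "dist (f s) (f t) \<le> dist (l s) (l t)" if "s \<in> S" "t \<in> S" for s t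
    using that mono_onD[OF f, of s t] mono_onD[OF f, of t s] mono_onD[OF lf, of s t] mono_onD[OF lf, of t s]
    by (cases "s \<le> t") (auto simp: dist_real_def)
  then show ?thesis using l unfolding continuous_on_iff by (meson le_less_trans)
qed

text \<open>Path continuity reduces the supremum over \<open>{0..t}\<close> to one over a countable
  dense subset.\<close>

lemma regulator_measurable:
  fixes Y :: "real \<Rightarrow> 'a \<Rightarrow> real"
  assumes t: "0 \<le> t"
    and meas: "\<And>s. 0 \<le> s \<Longrightarrow> s \<le> t \<Longrightarrow> Y s \<in> borel_measurable N"
    and cont: "\<And>\<omega>. \<omega> \<in> space N \<Longrightarrow> continuous_on {0..} (\<lambda>s. Y s \<omega>)"
  shows "(\<lambda>\<omega>. regulator (\<lambda>s. Y s \<omega>) t) \<in> borel_measurable N"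
proof -
  define D where "D = insert 0 (\<rat> \<inter> {0..t})"
  have D: "countable D" "D \<subseteq> {0..t}" "D \<noteq> {}" using t countable_rat by (auto simp: D_def)
  have eq: "regulator (\<lambda>s. Y s \<omega>) t = (SUP s\<in>D. max 0 (- Y s \<omega>))"
    and bdd: "bdd_above ((\<lambda>s. max 0 (- Y s \<omega>)) ` D)" if \<omega>: "\<omega> \<in> space N" for \<omega>
  proof -
    let ?g = "\<lambda>s. max 0 (- Y s \<omega>)"
    have cg: "continuous_on {0..} ?g" using cont[OF \<omega>] by (intro continuous_intros) auto
    have "compact (?g ` {0..t})"
      by (intro compact_continuous_image continuous_on_subset[OF cg]) auto
    then have bt: "bdd_above (?g ` {0..t})"
      by (simp add: bounded_imp_bdd_above compact_imp_bounded)
    then show bD: "bdd_above (?g ` D)" by (rule bdd_above_mono) (use D in auto)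
    show "regulator (\<lambda>s. Y s \<omega>) t = (SUP s\<in>D. ?g s)"
    proof (rule antisym)
      show "(SUP s\<in>D. ?g s) \<le> regulator (\<lambda>s. Y s \<omega>) t"
        unfolding regulator_def by (rule cSUP_subset_mono) (use D bt in auto)
      show "regulator (\<lambda>s. Y s \<omega>) t \<le> (SUP s\<in>D. ?g s)"
        unfolding regulator_def
      proof (rule cSUP_least)
        fix s assume s: "s \<in> {0..t}"
        show "?g s \<le> (SUP s\<in>D. ?g s)"
        proof (rule ccontr)
          assume "\<not> ?thesis"
          then have e: "0 < ?g s - (SUP s\<in>D. ?g s)" (is "0 < ?e") by auto
          then obtain \<delta> where \<delta>: "\<delta> > 0" "\<And>r. 0 \<le> r \<Longrightarrow> dist r s < \<delta> \<Longrightarrow> dist (?g r) (?g s) < ?e"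
            using cg s unfolding continuous_on_iff by (metis atLeast_iff atLeastAtMost_iff)
          \<comment> \<open>The rational is chosen to the left of \<open>s\<close>, so that it
            cannot exceed \<open>t\<close>; only \<open>s = 0\<close> needs its own point.\<close>
          obtain r where r: "r \<in> D" "dist r s < \<delta>"
          proof (cases "s = 0")
            case True
            then show thesis using that[of 0] \<delta> by (auto simp: D_def)
          next
            case False
            then obtain r where "r \<in> \<rat>" "max 0 (s - \<delta>) < r" "r < s"
              using Rats_dense_in_real[of "max 0 (s - \<delta>)" s] s \<delta> by auto
            then show thesis using that[of r] s by (auto simp: D_def dist_real_def)
          qed
          have "?g r \<le> (SUP s\<in>D. ?g s)" using r bD by (intro cSUP_upper)
          moreover have "dist (?g r) (?g s) < ?e" using r D by (intro \<delta>(2)) auto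
          ultimately show False unfolding dist_real_def by linarith
        qed
      qed (use t in auto)
    qed
  qed
  have "(\<lambda>\<omega>. SUP s\<in>D. max 0 (- Y s \<omega>)) \<in> borel_measurable N"
    using D meas bdd by (intro borel_measurable_cSUP borel_measurable_max borel_measurable_uminus) auto
  then show ?thesis using eq by (subst measurable_cong) auto
qed

section \<open>Picard iteration for the multidimensional Skorokhod problem\<close>

text \<open>Iteration for the fixed-point equation \<open>l k = regulator (x k - (Q l) k)\<close>,
  where \<open>Q\<close> is the identity minus the reflection matrix. Starting from zero makes the
  iterates increase with \<open>n\<close> when \<open>Q\<close> is nonnegative.\<close>

primrec skorokhod_iter :: "(nat \<Rightarrow> nat \<Rightarrow> real) \<Rightarrow> nat \<Rightarrow> (real \<Rightarrow> nat \<Rightarrow> real) \<Rightarrow> nat \<Rightarrow> real \<Rightarrow> nat \<Rightarrow> real" where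
  "skorokhod_iter Q m x 0 = (\<lambda>t k. 0)"
| "skorokhod_iter Q m x (Suc n) =
     (\<lambda>t k. regulator (\<lambda>s. x s k - (\<Sum>j<m. Q k j * skorokhod_iter Q m x n s j)) t)"

definition skorokhod_regulator :: "(nat \<Rightarrow> nat \<Rightarrow> real) \<Rightarrow> nat \<Rightarrow> (real \<Rightarrow> nat \<Rightarrow> real) \<Rightarrow> real \<Rightarrow> nat \<Rightarrow> real" where
  "skorokhod_regulator Q m x t k = lim (\<lambda>n. skorokhod_iter Q m x n t k)"

text \<open>A solution \<^term>\<open>l\<close> of the Skorokhod problem for the driving path \<^term>\<open>\<lambda>t k. x t k - v t k\<close>
  with reflection matrix \<open>1 - Q\<close>. Its mere existence bounds the Picard iterates for
  \<^term>\<open>x\<close>, so that no spectral condition on \<^term>\<open>Q\<close> is needed for their convergence.\<close>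

locale dominating_solution =
  fixes Q :: "nat \<Rightarrow> nat \<Rightarrow> real" and m :: nat and x v l :: "real \<Rightarrow> nat \<Rightarrow> real"
  assumes Q_nonneg: "i < m \<Longrightarrow> j < m \<Longrightarrow> 0 \<le> Q i j"
    and x_cont: "k < m \<Longrightarrow> continuous_on {0..} (\<lambda>t. x t k)"
    and v_cont: "k < m \<Longrightarrow> continuous_on {0..} (\<lambda>t. v t k)"
    and l_cont: "k < m \<Longrightarrow> continuous_on {0..} (\<lambda>t. l t k)"
    and v_mono: "k < m \<Longrightarrow> mono_on {0..} (\<lambda>t. v t k)"
    and l_mono: "k < m \<Longrightarrow> mono_on {0..} (\<lambda>t. l t k)"
    and v_zero: "k < m \<Longrightarrow> v 0 k = 0"
    and l_zero: "k < m \<Longrightarrow> l 0 k = 0"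
    and nonneg: "k < m \<Longrightarrow> 0 \<le> t \<Longrightarrow> 0 \<le> x t k - v t k - (\<Sum>j<m. Q k j * l t j) + l t k"
    and complementary: "k < m \<Longrightarrow>
      (\<integral>\<^sup>+ t\<in>{0..}. ennreal (x t k - v t k - (\<Sum>j<m. Q k j * l t j) + l t k)
         \<partial>(interval_measure (\<lambda>t. l (max t 0) k))) = 0"
begin

abbreviation "iter \<equiv> skorokhod_iter Q m x"
abbreviation "L \<equiv> skorokhod_regulator Q m x"

text \<open>Coordinate \<open>k\<close> before its own regulation, so that
  \<open>free n k t + iter (Suc n) t k\<close> approximates the reflected path.\<close>

definition free :: "nat \<Rightarrow> nat \<Rightarrow> real \<Rightarrow> real" where
  "free n k t = x t k - (\<Sum>j<m. Q k j * iter n t j)"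

definition free_lim :: "nat \<Rightarrow> real \<Rightarrow> real" where
  "free_lim k t = x t k - (\<Sum>j<m. Q k j * L t j)"

lemma iter_Suc: "iter (Suc n) t k = regulator (free n k) t"
  by (simp add: free_def[abs_def])

lemma l_last_zero:
  assumes k: "k < m" and s: "0 \<le> s"
  shows "l s k = 0 \<or> (\<exists>u. 0 \<le> u \<and> u \<le> s \<and> x u k - v u k - (\<Sum>j<m. Q k j * l u j) + l u k = 0 \<and> l u k = l s k)"
  using nonneg[OF k] complementary[OF k] s
  by (intro last_zero_of_complementarity l_cont l_mono l_zero k continuous_intros x_cont v_cont) auto

text \<open>The path driving \<open>l\<close> is rewritten as \<open>free n k\<close> minus
  \<open>v + Q (l - iter n)\<close>. The subtracted part is nondecreasing because \<open>Q\<close>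
  is nonnegative and \<open>l - iter n\<close> is nondecreasing, so the one-dimensional comparison
  applies with it in place of \<open>v\<close>.\<close>

lemma comparison_step:
  assumes k: "k < m"
    and zero: "\<And>j. j < m \<Longrightarrow> iter n 0 j = 0"
    and mono: "\<And>j. j < m \<Longrightarrow> mono_on {0..} (\<lambda>t. l t j - iter n t j)"
  shows "0 \<le> t \<Longrightarrow> bdd_above ((\<lambda>s. max 0 (- free n k s)) ` {0..t})"
    and "0 \<le> t \<Longrightarrow> l t k \<le> iter (Suc n) t k + v t k + (\<Sum>j<m. Q k j * (l t j - iter n t j))"
    and "mono_on {0..} (\<lambda>t. l t k - iter (Suc n) t k)"
proof -
  let ?v = "\<lambda>t. v t k + (\<Sum>j<m. Q k j * (l t j - iter n t j))"
  have eq: "free n k t - ?v t + l t k = x t k - v t k - (\<Sum>j<m. Q k j * l t j) + l t k" for t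
    by (simp add: free_def algebra_simps sum_subtractf)
  have vm: "mono_on {0..} ?v"
  proof (rule mono_onI)
    fix r s :: real assume "r \<in> {0..}" "s \<in> {0..}" "r \<le> s"
    then show "?v r \<le> ?v s"
      by (intro add_mono sum_mono mult_left_mono mono_onD[OF v_mono] mono_onD[OF mono] Q_nonneg k) auto
  qed
  have v0: "?v 0 = 0" using k by (simp add: v_zero l_zero zero)
  note * = regulator_comparison[OF l_mono[OF k] l_zero[OF k] vm v0, of "free n k", unfolded eq,
      OF nonneg[OF k] l_last_zero[OF k]]
  show "bdd_above ((\<lambda>s. max 0 (- free n k s)) ` {0..t})" if "0 \<le> t" using that by (intro *(1))
  show "l t k \<le> iter (Suc n) t k + v t k + (\<Sum>j<m. Q k j * (l t j - iter n t j))" if "0 \<le> t"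
    unfolding iter_Suc add.assoc using that by (intro *(2))
  show "mono_on {0..} (\<lambda>t. l t k - iter (Suc n) t k)" unfolding iter_Suc by (intro *(3))
qed

text \<open>The induction carries monotonicity in time of \<open>l - iter n\<close>, which is
  stronger than \<open>iter n \<le> l\<close>: the comparison step needs a nondecreasing subtracted
  process.\<close>

lemma iter_invariant:
  "k < m \<Longrightarrow> iter n 0 k = 0 \<and> mono_on {0..} (\<lambda>t. iter n t k) \<and> mono_on {0..} (\<lambda>t. l t k - iter n t k)"
proof (induction n arbitrary: k)
  case 0
  then show ?case using l_mono by (auto intro!: mono_onI)
next
  case (Suc n)
  have zero: "iter n 0 j = 0" and mono: "mono_on {0..} (\<lambda>t. l t j - iter n t j)" if "j < m" for j
    using Suc.IH[OF that] by auto
  note step = comparison_step[of k n, OF Suc.prems zero mono]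
  \<comment> \<open>At time 0 all regulators vanish and \<open>x 0 k \<ge> 0\<close>, so nothing has
    to be pushed.\<close>
  have "free n k 0 \<ge> 0"
    using nonneg[OF Suc.prems, of 0] Suc.prems by (simp add: free_def zero v_zero l_zero)
  then have "iter (Suc n) 0 k = 0"
    unfolding iter_Suc by (simp add: regulator_def)
  moreover have "mono_on {0..} (\<lambda>t. iter (Suc n) t k)"
    unfolding iter_Suc by (rule regulator_mono_on[OF step(1)])
  ultimately show ?case using step(3) by blast
qed

lemmas iter_zero = iter_invariant[THEN conjunct1]
lemmas iter_mono = iter_invariant[THEN conjunct2, THEN conjunct1]
lemmas iter_dominated = iter_invariant[THEN conjunct2, THEN conjunct2]

lemma free_bdd: "k < m \<Longrightarrow> 0 \<le> t \<Longrightarrow> bdd_above ((\<lambda>s. max 0 (- free n k s)) ` {0..t})"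
  and l_le_iter: "k < m \<Longrightarrow> 0 \<le> t \<Longrightarrow> l t k \<le> iter (Suc n) t k + v t k + (\<Sum>j<m. Q k j * (l t j - iter n t j))"
  by (rule comparison_step; simp add: iter_zero iter_dominated)+

lemma iter_cont: "k < m \<Longrightarrow> continuous_on {0..} (\<lambda>t. iter n t k)"
  by (intro continuous_on_dominated_increments[OF iter_mono iter_dominated l_cont])

lemma free_cont: "k < m \<Longrightarrow> continuous_on {0..} (free n k)"
  unfolding free_def[abs_def] by (intro continuous_intros x_cont iter_cont) auto

lemma iter_nonneg: "k < m \<Longrightarrow> 0 \<le> t \<Longrightarrow> 0 \<le> iter n t k"
  using mono_onD[OF iter_mono, of k 0 t n] by (auto simp: iter_zero)

lemma iter_le_l: "k < m \<Longrightarrow> 0 \<le> t \<Longrightarrow> iter n t k \<le> l t k"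
  using mono_onD[OF iter_dominated, of k 0 t n] by (auto simp: iter_zero l_zero)

text \<open>A larger iterate lowers the free path, since \<open>Q\<close> is nonnegative, and
  thereby raises the next regulator.\<close>

lemma iter_incseq: "k < m \<Longrightarrow> 0 \<le> t \<Longrightarrow> iter n t k \<le> iter (Suc n) t k"
proof (induction n arbitrary: k t)
  case 0
  then show ?case using iter_nonneg[of k t "Suc 0"] by simp
next
  case (Suc n)
  show ?case unfolding iter_Suc[of n]
  proof (rule regulator_least)
    show "0 \<le> iter (Suc (Suc n)) t k" using Suc.prems by (rule iter_nonneg)
    fix s assume s: "0 \<le> s" "s \<le> t"
    have "- free n k s \<le> - free (Suc n) k s"
      unfolding free_def using Suc.IH Q_nonneg Suc.prems s
      by (simp del: skorokhod_iter.simps) (intro sum_mono mult_left_mono, auto)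
    also have "\<dots> \<le> iter (Suc (Suc n)) t k"
      unfolding iter_Suc[of "Suc n"] using Suc.prems s by (intro regulator_upper free_bdd) auto
    finally show "- free n k s \<le> iter (Suc (Suc n)) t k" .
  qed (use Suc.prems in auto)
qed

text \<open>The iterates increase in \<open>n\<close> and are bounded by \<open>l\<close>.\<close>

lemma iter_tendsto: "k < m \<Longrightarrow> 0 \<le> t \<Longrightarrow> (\<lambda>n. iter n t k) \<longlonglongrightarrow> L t k"
proof -
  assume *: "k < m" "0 \<le> t"
  have "incseq (\<lambda>n. iter n t k)" using * by (intro incseq_SucI iter_incseq)
  then have "convergent (\<lambda>n. iter n t k)"
    using iter_le_l[OF *] by (metis incseq_convergent convergentI)
  then show ?thesis unfolding skorokhod_regulator_def by (simp add: convergent_LIMSEQ_iff)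
qed

lemma iter_le_L: "k < m \<Longrightarrow> 0 \<le> t \<Longrightarrow> iter n t k \<le> L t k"
  by (rule incseq_le[OF incseq_SucI]) (auto intro: iter_tendsto iter_incseq simp del: skorokhod_iter.simps)

lemma L_zero: "k < m \<Longrightarrow> L 0 k = 0"
  using LIMSEQ_unique[OF iter_tendsto[of k 0]] by (auto simp: iter_zero)

lemma L_mono: "k < m \<Longrightarrow> mono_on {0..} (\<lambda>t. L t k)"
proof (rule mono_onI)
  fix r s :: real assume *: "k < m" "r \<in> {0..}" "s \<in> {0..}" "r \<le> s"
  from LIMSEQ_le[OF iter_tendsto iter_tendsto, of k r k s] show "L r k \<le> L s k"
    using * mono_onD[OF iter_mono, of k r s] by auto
qed

lemma L_dominated: "k < m \<Longrightarrow> mono_on {0..} (\<lambda>t. l t k - L t k)"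
proof (rule mono_onI)
  fix r s :: real assume *: "k < m" "r \<in> {0..}" "s \<in> {0..}" "r \<le> s"
  have "(\<lambda>n. l t k - iter n t k) \<longlonglongrightarrow> l t k - L t k" if "0 \<le> t" for t
    using * that by (intro tendsto_intros iter_tendsto)
  from LIMSEQ_le[OF this this, of r s] show "l r k - L r k \<le> l s k - L s k"
    using * mono_onD[OF iter_dominated, of k r s] by auto
qed

text \<open>Monotonicity in time of both \<open>L\<close> and \<open>l - L\<close> survives the
  pointwise limit, so continuity follows by domination.\<close>

lemma L_cont: "k < m \<Longrightarrow> continuous_on {0..} (\<lambda>t. L t k)"
  by (intro continuous_on_dominated_increments[OF L_mono L_dominated l_cont])

lemma L_nonneg: "k < m \<Longrightarrow> 0 \<le> t \<Longrightarrow> 0 \<le> L t k"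
  using mono_onD[OF L_mono, of k 0 t] by (auto simp: L_zero)

lemma free_tendsto: "k < m \<Longrightarrow> 0 \<le> t \<Longrightarrow> (\<lambda>n. free n k t) \<longlonglongrightarrow> free_lim k t"
  unfolding free_def free_lim_def by (intro tendsto_intros iter_tendsto) auto

lemma free_lim_cont: "k < m \<Longrightarrow> continuous_on {0..} (free_lim k)"
  unfolding free_lim_def[abs_def] by (intro continuous_intros x_cont L_cont) auto

lemma free_lim_le: "k < m \<Longrightarrow> 0 \<le> t \<Longrightarrow> free_lim k t \<le> free n k t"
  unfolding free_def free_lim_def 
  by (intro diff_left_mono sum_mono mult_left_mono Q_nonneg iter_le_L) auto

lemma minus_free_lim_le: "k < m \<Longrightarrow> 0 \<le> s \<Longrightarrow> s \<le> t \<Longrightarrow> - free_lim k s \<le> L t k"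
proof -
  assume *: "k < m" "0 \<le> s" "s \<le> t"
  have le: "- free n k s \<le> L t k" for n
  proof -
    have "- free n k s \<le> iter (Suc n) t k"
      unfolding iter_Suc using * by (intro regulator_upper free_bdd) auto
    also have "\<dots> \<le> L t k" using * by (intro iter_le_L) auto
    finally show ?thesis .
  qed
  show ?thesis
    by (rule LIMSEQ_le_const2[OF tendsto_minus[OF free_tendsto]]) (use * le in auto)
qed

lemma free_lim_bdd: "k < m \<Longrightarrow> 0 \<le> t \<Longrightarrow> bdd_above ((\<lambda>s. max 0 (- free_lim k s)) ` {0..t})"
  by (rule bdd_aboveI2[of _ _ "L t k"]) (auto intro: minus_free_lim_le L_nonneg)

text \<open>Two inequalities from order alone: \<open>L\<close> is nonnegative and bounds
  \<open>- free_lim\<close> at all earlier times, hence is at least its regulator; conversely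
  \<open>free_lim\<close> lies below every \<open>free n\<close>, so every iterate is at most the
  regulator of \<open>free_lim\<close>.\<close>

lemma L_fixed_point: "k < m \<Longrightarrow> 0 \<le> t \<Longrightarrow> L t k = regulator (free_lim k) t"
proof (rule antisym)
  assume *: "k < m" "0 \<le> t"
  show "regulator (free_lim k) t \<le> L t k"
    using * by (intro regulator_least L_nonneg minus_free_lim_le)
  have "iter (Suc n) t k \<le> regulator (free_lim k) t" for n
    unfolding iter_Suc
  proof (rule regulator_least)
    show "0 \<le> regulator (free_lim k) t"
      using * by (intro regulator_upper(1)[of _ _ t] free_lim_bdd) auto
    fix s assume s: "0 \<le> s" "s \<le> t"
    have "- free n k s \<le> - free_lim k s" using free_lim_le[of k s n] * s by auto
    also have "\<dots> \<le> regulator (free_lim k) t" using * s by (intro regulator_upper free_lim_bdd)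
    finally show "- free n k s \<le> regulator (free_lim k) t" .
  qed (use * in auto)
  then show "L t k \<le> regulator (free_lim k) t"
    by (intro LIMSEQ_le_const2[OF LIMSEQ_Suc[OF iter_tendsto]]) (use * in auto)
qed

lemma reflected_nonneg: "k < m \<Longrightarrow> 0 \<le> t \<Longrightarrow> 0 \<le> free_lim k t + L t k"
  using minus_free_lim_le[of k t t] by auto

text \<open>By the fixed-point equation \<open>L\<close> is a one-dimensional regulator, and so is
  flat while the reflected path is positive.\<close>

lemma L_complementary:
  assumes k: "k < m"
  shows "(\<integral>\<^sup>+ t\<in>{0..}. ennreal (free_lim k t + L t k) \<partial>(interval_measure (\<lambda>t. L (max t 0) k))) = 0"
proof (rule complementarity_of_flat)
  fix a b assume *: "0 \<le> a" "a \<le> b" "\<And>t. a \<le> t \<Longrightarrow> t \<le> b \<Longrightarrow> 0 < free_lim k t + L t k"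
  have "regulator (free_lim k) b = regulator (free_lim k) a"
    by (rule regulator_flat[OF free_lim_cont[OF k] *(1,2) _ free_lim_bdd[OF k]])
      (use * k in \<open>auto simp: L_fixed_point[symmetric]\<close>)
  then show "L b k = L a k" using * k by (simp add: L_fixed_point)
qed (use k in \<open>auto intro!: L_cont L_mono reflected_nonneg continuous_intros free_lim_cont\<close>)

text \<open>The bound \<open>l_le_iter\<close>, rearranged, places the given reflected path below
  \<open>free n k + iter (Suc n)\<close>; the index shift disappears in the limit.\<close>

lemma reflected_le:
  assumes k: "k < m" and t: "0 \<le> t"
  shows "x t k - v t k - (\<Sum>j<m. Q k j * l t j) + l t k \<le> free_lim k t + L t k"
proof -
  have "x t k - v t k - (\<Sum>j<m. Q k j * l t j) + l t k \<le> free n k t + iter (Suc n) t k" for n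
    using l_le_iter[OF k t, of n] unfolding free_def by (simp add: algebra_simps sum_subtractf)
  then show ?thesis
    by (intro LIMSEQ_le_const[OF tendsto_add[OF free_tendsto LIMSEQ_Suc[OF iter_tendsto]]])
      (use k t in auto)
qed

end

section \<open>Adaptedness of the constructed regulator\<close>

text \<open>The regulator at time \<open>t\<close> looks only at times up to \<open>t\<close>, and
  the filtration is increasing. The solution assumed for each sample point supplies the path
  continuity that measurability of the supremum requires.\<close>

lemma skorokhod_iter_adapted:
  assumes F: "filtration \<Omega> F"
    and X: "\<And>t k. 0 \<le> t \<Longrightarrow> k < m \<Longrightarrow> (\<lambda>\<omega>. X \<omega> t k) \<in> borel_measurable (F t)"
    and sol: "\<And>\<omega>. \<omega> \<in> \<Omega> \<Longrightarrow> dominating_solution Q m (X \<omega>) (v \<omega>) (l \<omega>)"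
  shows "0 \<le> t \<Longrightarrow> k < m \<Longrightarrow> (\<lambda>\<omega>. skorokhod_iter Q m (X \<omega>) n t k) \<in> borel_measurable (F t)"
proof (induction n arbitrary: t k)
  case 0
  then show ?case by simp
next
  case (Suc n)
  have later: "f \<in> borel_measurable (F t)" if "f \<in> borel_measurable (F s)" "s \<le> t" for f :: "'a \<Rightarrow> real" and s
    using that filtration.sets_F_mono[OF F] filtration.space_F[OF F]
    by (auto simp: measurable_def)
  show ?case unfolding skorokhod_iter.simps
  proof (rule regulator_measurable)
    fix s assume s: "0 \<le> s" "s \<le> t"
    show "(\<lambda>\<omega>. X \<omega> s k - (\<Sum>j<m. Q k j * skorokhod_iter Q m (X \<omega>) n s j)) \<in> borel_measurable (F t)"
      by (rule later[OF _ s(2)], intro borel_measurable_diff borel_measurable_sum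
          borel_measurable_times borel_measurable_const X Suc.IH) (use s Suc.prems in auto)
  next
    fix \<omega> assume "\<omega> \<in> space (F t)"
    then interpret dominating_solution Q m "X \<omega>" "v \<omega>" "l \<omega>"
      using sol filtration.space_F[OF F] by simp
    show "continuous_on {0..} (\<lambda>s. X \<omega> s k - (\<Sum>j<m. Q k j * skorokhod_iter Q m (X \<omega>) n s j))"
      using free_cont[OF Suc.prems(2), of n] unfolding free_def[abs_def] .
  qed (use Suc.prems in auto)
qed

lemma skorokhod_regulator_adapted:
  assumes F: "filtration \<Omega> F"
    and X: "\<And>t k. 0 \<le> t \<Longrightarrow> k < m \<Longrightarrow> (\<lambda>\<omega>. X \<omega> t k) \<in> borel_measurable (F t)"
    and sol: "\<And>\<omega>. \<omega> \<in> \<Omega> \<Longrightarrow> dominating_solution Q m (X \<omega>) (v \<omega>) (l \<omega>)"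
    and t: "0 \<le> t" and k: "k < m"
  shows "(\<lambda>\<omega>. skorokhod_regulator Q m (X \<omega>) t k) \<in> borel_measurable (F t)"
proof (rule borel_measurable_LIMSEQ_real)
  show "(\<lambda>\<omega>. skorokhod_iter Q m (X \<omega>) n t k) \<in> borel_measurable (F t)" for n
    by (rule skorokhod_iter_adapted[OF F X sol t k])
  fix \<omega> assume "\<omega> \<in> space (F t)"
  then interpret dominating_solution Q m "X \<omega>" "v \<omega>" "l \<omega>"
    using sol filtration.space_F[OF F] by simp
  show "(\<lambda>n. skorokhod_iter Q m (X \<omega>) n t k) \<longlonglongrightarrow> skorokhod_regulator Q m (X \<omega>) t k"
    by (rule iter_tendsto[OF k t])
qed

section \<open>Restriction of a Brownian motion to a set of coordinates\<close>

lemma bij_betw_sorted_list_nth: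
  "finite I \<Longrightarrow> bij_betw (\<lambda>k. sorted_list_of_set I ! k) {..<card I} I"
  by (rule bij_betw_nth) auto

lemma sorted_list_nth_less:
  fixes I :: "nat set"
  assumes "I \<subseteq> {..<d}" "k < card I"
  shows "sorted_list_of_set I ! k < d"
  using bij_betwE[OF bij_betw_sorted_list_nth[OF finite_subset[OF assms(1)]]] assms by auto

text \<open>The increment law is stated through linear combinations, and a combination of the
  selected coordinates is one of all coordinates with coefficients extended by zero.\<close>

lemma brownian_sub_vec:
  assumes B: "brownian M F d \<mu> A z B" and I: "I \<subseteq> {..<d}"
  shows "brownian M F (card I) (sub_vec I \<mu>) (sub_mat I A) (sub_vec I z) (\<lambda>t \<omega>. sub_vec I (B t \<omega>))"
proof -
  let ?e = "\<lambda>k. sorted_list_of_set I ! k"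
  have fin: "finite I" using I finite_subset by blast
  note bij = bij_betw_sorted_list_nth[OF fin] and less = sorted_list_nth_less[OF I]
  define ext where "ext u j = (if j \<in> I then u (inv_into {..<card I} ?e j) else 0)" for u :: "nat \<Rightarrow> real" and j
  have ext: "(\<Sum>j<d. ext u j * f j) = (\<Sum>k<card I. u k * f (?e k))" for u f
  proof -
    have "(\<Sum>j<d. ext u j * f j) = (\<Sum>j\<in>I. ext u j * f j)"
      by (rule sum.mono_neutral_right) (use I in \<open>auto simp: ext_def\<close>)
    also have "\<dots> = (\<Sum>k<card I. ext u (?e k) * f (?e k))"
      by (rule sum.reindex_bij_betw[OF bij, symmetric])
    also have "\<dots> = (\<Sum>k<card I. u k * f (?e k))"
      using bij_betw_inv_into_left[OF bij] bij_betwE[OF bij] by (intro sum.cong) (auto simp: ext_def)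
    finally show ?thesis .
  qed
  have ext2: "(\<Sum>i<d. \<Sum>j<d. ext u i * A i j * ext u j) =
      (\<Sum>i<card I. \<Sum>j<card I. u i * A (?e i) (?e j) * u j)" for u
  proof -
    \<comment> \<open>Regrouped so that \<open>ext\<close> applies to both the inner and the outer
      sum.\<close>
    have "(\<Sum>i<d. \<Sum>j<d. ext u i * A i j * ext u j) = (\<Sum>i<d. ext u i * (\<Sum>j<d. ext u j * A i j))"
      by (simp add: sum_distrib_left mult_ac)
    also have "\<dots> = (\<Sum>i<card I. \<Sum>j<card I. u i * A (?e i) (?e j) * u j)"
      unfolding ext by (simp add: sum_distrib_left mult_ac)
    finally show ?thesis .
  qed
  have increments: "\<forall>s t. 0 \<le> s \<longrightarrow> s < t \<longrightarrow> (\<forall>u. \<forall>E\<in>sets (F s). \<forall>C\<in>sets borel.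
      measure M (E \<inter> {\<omega>\<in>space M. (\<Sum>k<d. u k * (B t \<omega> k - B s \<omega> k)) \<in> C}) =
        measure M E * measure (gauss ((t - s) * (\<Sum>k<d. u k * \<mu> k))
          ((t - s) * (\<Sum>i<d. \<Sum>j<d. u i * A i j * u j))) C)"
    using B unfolding brownian_def by (elim conjE)
  have "measure M (E \<inter> {\<omega>\<in>space M. (\<Sum>k<card I. u k * (B t \<omega> (?e k) - B s \<omega> (?e k))) \<in> C}) =
        measure M E * measure (gauss ((t - s) * (\<Sum>k<card I. u k * \<mu> (?e k)))
          ((t - s) * (\<Sum>i<card I. \<Sum>j<card I. u i * A (?e i) (?e j) * u j))) C"
    if "0 \<le> s" "s < t" "E \<in> sets (F s)" "C \<in> sets borel" for s t u E C
    using increments[rule_format, OF that, of "ext u"] unfolding ext ext2 .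
  then show ?thesis
    using B less unfolding brownian_def adapted_cont_def sub_vec_def sub_mat_def by simp
qed

section \<open>Comparison on a common probability space\<close>

theorem theorem3p7:
  fixes d :: nat and \<mu> :: "nat \<Rightarrow> real" and A R :: "nat \<Rightarrow> nat \<Rightarrow> real" and I :: "nat set"
  assumes "d \<ge> 1"
    and "sym_pos_def d A"
    and "reflection_M_matrix d R"
    and "I \<noteq> {}" and "I \<subseteq> {0..<d}"
    and "srbm_hits TYPE('a) (card I) (sub_mat I R) (sub_vec I \<mu>) (sub_mat I A) {0..<card I}"
  shows "srbm_hits TYPE('a) d R \<mu> A I"
  unfolding srbm_hits_def
proof (intro allI impI notI)
  fix z :: "nat \<Rightarrow> real" and M :: "'a measure" and F Z
  assume z: "\<forall>k<d. 0 \<le> z k" and srbm: "is_srbm M F d R \<mu> A z Z"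
    and avoid: "AE \<omega> in M. \<forall>t>0. \<not> (\<forall>k\<in>I. Z t \<omega> k = 0)"
  obtain B L where B: "brownian M F d \<mu> A z B" and L: "adapted_cont M F d L"
    and ZBL_all: "\<forall>\<omega>\<in>space M. \<forall>t\<ge>0. \<forall>k<d. Z t \<omega> k = B t \<omega> k + (\<Sum>j<d. R k j * L t \<omega> j)"
    and Z0_all: "\<forall>\<omega>\<in>space M. \<forall>t\<ge>0. \<forall>k<d. Z t \<omega> k \<ge> 0"
    and L_all: "\<forall>\<omega>\<in>space M. \<forall>k<d. L 0 \<omega> k = 0 \<and> mono_on {0..} (\<lambda>t. L t \<omega> k) \<and>
        (\<integral>\<^sup>+ t\<in>{0..}. ennreal (Z t \<omega> k) \<partial>(interval_measure (\<lambda>t. L (max t 0) \<omega> k))) = 0"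
    using srbm unfolding is_srbm_def by (elim exE conjE)
  note ZBL = ZBL_all[rule_format] and Z0 = Z0_all[rule_format]
  note L0 = L_all[rule_format, THEN conjunct1]
    and Lm = L_all[rule_format, THEN conjunct2, THEN conjunct1]
    and ZL = L_all[rule_format, THEN conjunct2, THEN conjunct2]
  define m where "m = card I"
  define e where "e k = sorted_list_of_set I ! k" for k
  have I: "I \<subseteq> {..<d}" using assms(5) by auto
  have fin: "finite I" using I finite_subset by blast
  have bij: "bij_betw e {..<m} I"
    using bij_betw_sorted_list_nth[OF fin] unfolding e_def[abs_def] m_def .
  have e: "e k \<in> I" "e k < d" if "k < m" for k using bij_betwE[OF bij] that I by auto
  have e_inj: "e i = e j \<longleftrightarrow> i = j" if "i < m" "j < m" for i j
    using bij that by (auto simp: bij_betw_def inj_on_def)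
  have Rdiag: "R i i = 1" if "i < d" for i
    using assms(3) that by (auto simp: reflection_M_matrix_def)
  have Roff: "R i j \<le> 0" if "i < d" "j < d" "i \<noteq> j" for i j
    using assms(3) that by (auto simp: reflection_M_matrix_def)
  \<comment> \<open>The identity minus the submatrix of \<open>R\<close>; the unit diagonal of
    \<open>R\<close> produces the zeros.\<close>
  define Q where "Q i j = (if i = j then 0 else - R (e i) (e j))" for i j
  have RQ: "(\<Sum>j<m. R (e k) (e j) * a j) = a k - (\<Sum>j<m. Q k j * a j)" if "k < m" for k and a :: "nat \<Rightarrow> real"
  proof -
    have "(\<Sum>j<m. R (e k) (e j) * a j) = (\<Sum>j<m. (if k = j then a j else 0) - Q k j * a j)"
      using Rdiag e that by (intro sum.cong) (auto simp: Q_def)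
    then show ?thesis using that by (simp add: sum_subtractf)
  qed
  define X where "X \<omega> t k = B t \<omega> (e k)" for \<omega> t k
  \<comment> \<open>The downward push on coordinate \<open>e k\<close> caused by the coordinates
    outside \<open>I\<close>. All entries of \<open>R\<close> involved are off-diagonal, so
    \<open>V\<close> is nondecreasing in time.\<close>
  define V where "V \<omega> t k = (\<Sum>j\<in>{..<d} - I. - R (e k) j * L t \<omega> j)" for \<omega> t k
  define l where "l \<omega> t k = L t \<omega> (e k)" for \<omega> t k
  have Z_eq: "Z t \<omega> (e k) = X \<omega> t k - V \<omega> t k - (\<Sum>j<m. Q k j * l \<omega> t j) + l \<omega> t k"
    if "\<omega> \<in> space M" "0 \<le> t" "k < m" for \<omega> t k
  proof -
    have "(\<Sum>j<d. R (e k) j * L t \<omega> j) = (\<Sum>j\<in>{..<d} - I. R (e k) j * L t \<omega> j) + (\<Sum>j\<in>I. R (e k) j * L t \<omega> j)"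
      using I by (intro sum.subset_diff) auto
    also have "(\<Sum>j\<in>I. R (e k) j * L t \<omega> j) = (\<Sum>j<m. R (e k) (e j) * l \<omega> t j)"
      unfolding l_def by (rule sum.reindex_bij_betw[OF bij, symmetric])
    also have "\<dots> = l \<omega> t k - (\<Sum>j<m. Q k j * l \<omega> t j)" by (rule RQ[OF that(3)])
    finally show ?thesis
      using ZBL[OF that(1,2) e(2)[OF that(3)]] by (simp add: X_def V_def sum_negf)
  qed
  have Bad: "adapted_cont M F d B" using B by (simp add: brownian_def)
  have Bc: "continuous_on {0..} (\<lambda>t. B t \<omega> k)" and Lc: "continuous_on {0..} (\<lambda>t. L t \<omega> k)"
    if "\<omega> \<in> space M" "k < d" for \<omega> k
    using Bad L that unfolding adapted_cont_def by blast+
  \<comment> \<open>The original process, read on the coordinates in \<open>I\<close>, is itself the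
    dominating solution, with driving path \<open>X - V\<close>.\<close>
  have sol: "dominating_solution Q m (X \<omega>) (V \<omega>) (l \<omega>)" if \<omega>: "\<omega> \<in> space M" for \<omega>
  proof
    fix i j assume "i < m" "j < m"
    then show "0 \<le> Q i j" using Roff e e_inj by (auto simp: Q_def)
  next
    fix k assume k: "k < m"
    show "continuous_on {0..} (\<lambda>t. X \<omega> t k)" "continuous_on {0..} (\<lambda>t. V \<omega> t k)"
      "continuous_on {0..} (\<lambda>t. l \<omega> t k)" "V \<omega> 0 k = 0" "l \<omega> 0 k = 0" "mono_on {0..} (\<lambda>t. l \<omega> t k)"
      unfolding X_def V_def l_def using k \<omega> e by (auto intro!: continuous_intros Bc Lc Lm simp: L0)
    show "mono_on {0..} (\<lambda>t. V \<omega> t k)"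
    proof (rule mono_onI)
      fix r s :: real assume "r \<in> {0..}" "s \<in> {0..}" "r \<le> s"
      moreover have "0 \<le> - R (e k) j" if "j \<in> {..<d} - I" for j
        using Roff[of "e k" j] e[OF k] that by auto
      ultimately show "V \<omega> r k \<le> V \<omega> s k"
        unfolding V_def using \<omega> by (intro sum_mono mult_left_mono mono_onD[OF Lm]) auto
    qed
    show "0 \<le> X \<omega> t k - V \<omega> t k - (\<Sum>j<m. Q k j * l \<omega> t j) + l \<omega> t k" if "0 \<le> t" for t
      using Z0[OF \<omega> that e(2)[OF k]] Z_eq[OF \<omega> that k] by simp
    have "(\<integral>\<^sup>+ t\<in>{0..}. ennreal (X \<omega> t k - V \<omega> t k - (\<Sum>j<m. Q k j * l \<omega> t j) + l \<omega> t k)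
         \<partial>(interval_measure (\<lambda>t. l \<omega> (max t 0) k))) =
      (\<integral>\<^sup>+ t\<in>{0..}. ennreal (Z t \<omega> (e k)) \<partial>(interval_measure (\<lambda>t. L (max t 0) \<omega> (e k))))"
      unfolding l_def[of \<omega> _ k, symmetric]
      by (intro nn_integral_cong) (auto simp: indicator_def Z_eq \<omega> k)
    also have "\<dots> = 0" by (rule ZL[OF \<omega> e(2)[OF k]])
    finally show "(\<integral>\<^sup>+ t\<in>{0..}. ennreal (X \<omega> t k - V \<omega> t k - (\<Sum>j<m. Q k j * l \<omega> t j) + l \<omega> t k)
         \<partial>(interval_measure (\<lambda>t. l \<omega> (max t 0) k))) = 0" .
  qed
  define L' where "L' t \<omega> = skorokhod_regulator Q m (X \<omega>) t" for t \<omega>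
  define Z' where "Z' t \<omega> k = X \<omega> t k - (\<Sum>j<m. Q k j * L' t \<omega> j) + L' t \<omega> k" for t \<omega> k
  have F: "filtration (space M) F" using B by (auto simp: brownian_def filtered_prob_def)
  have X_meas: "(\<lambda>\<omega>. X \<omega> t k) \<in> borel_measurable (F t)" if "0 \<le> t" "k < m" for t k
    using Bad that e unfolding adapted_cont_def X_def by simp
  have path: "L' 0 \<omega> k = 0" "mono_on {0..} (\<lambda>t. L' t \<omega> k)" "continuous_on {0..} (\<lambda>t. L' t \<omega> k)"
      "continuous_on {0..} (\<lambda>t. Z' t \<omega> k)" "\<And>t. 0 \<le> t \<Longrightarrow> 0 \<le> Z' t \<omega> k"
      "(\<integral>\<^sup>+ t\<in>{0..}. ennreal (Z' t \<omega> k) \<partial>(interval_measure (\<lambda>t. L' (max t 0) \<omega> k))) = 0"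
      "\<And>t. 0 \<le> t \<Longrightarrow> Z t \<omega> (e k) \<le> Z' t \<omega> k"
    if \<omega>: "\<omega> \<in> space M" and k: "k < m" for \<omega> k
  proof -
    interpret dominating_solution Q m "X \<omega>" "V \<omega>" "l \<omega>" by (rule sol[OF \<omega>])
    have Z': "Z' t \<omega> k = free_lim k t + skorokhod_regulator Q m (X \<omega>) t k" for t
      by (simp add: Z'_def free_lim_def L'_def)
    show "L' 0 \<omega> k = 0" "mono_on {0..} (\<lambda>t. L' t \<omega> k)" "continuous_on {0..} (\<lambda>t. L' t \<omega> k)"
      unfolding L'_def using k by (rule L_zero L_mono L_cont)+
    show "continuous_on {0..} (\<lambda>t. Z' t \<omega> k)"
      unfolding Z' using k by (intro continuous_on_add free_lim_cont L_cont)
    show "0 \<le> Z' t \<omega> k" if "0 \<le> t" for t unfolding Z' by (rule reflected_nonneg[OF k that])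
    show "(\<integral>\<^sup>+ t\<in>{0..}. ennreal (Z' t \<omega> k) \<partial>(interval_measure (\<lambda>t. L' (max t 0) \<omega> k))) = 0"
      unfolding Z' unfolding L'_def by (rule L_complementary[OF k])
    show "Z t \<omega> (e k) \<le> Z' t \<omega> k" if "0 \<le> t" for t
      unfolding Z' Z_eq[OF \<omega> that k] by (rule reflected_le[OF k that])
  qed
  have L'_meas: "(\<lambda>\<omega>. L' t \<omega> k) \<in> borel_measurable (F t)" if "0 \<le> t" "k < m" for t k
    unfolding L'_def by (rule skorokhod_regulator_adapted[OF F X_meas sol that])
  have "(\<lambda>\<omega>. Z' t \<omega> k) \<in> borel_measurable (F t)" if "0 \<le> t" "k < m" for t k
    unfolding Z'_def using that by (intro borel_measurable_add borel_measurable_diff borel_measurable_sum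
        borel_measurable_times borel_measurable_const X_meas L'_meas) auto
  then have ad: "adapted_cont M F m L'" "adapted_cont M F m Z'"
    unfolding adapted_cont_def using L'_meas path by auto
  \<comment> \<open>The lower-dimensional process lives on the same \<open>M\<close> and
    \<open>F\<close>, so the hitting assumption for sample type \<open>'a\<close> applies to it,
    started at the subvector of \<open>z\<close>.\<close>
  have "is_srbm M F m (sub_mat I R) (sub_vec I \<mu>) (sub_mat I A) (sub_vec I z) Z'"
    unfolding is_srbm_def
  proof (rule exI[of _ "\<lambda>t \<omega>. sub_vec I (B t \<omega>)"], rule exI[of _ L'], intro conjI)
    show "brownian M F m (sub_vec I \<mu>) (sub_mat I A) (sub_vec I z) (\<lambda>t \<omega>. sub_vec I (B t \<omega>))"
      unfolding m_def by (rule brownian_sub_vec[OF B I])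
    show "\<forall>\<omega>\<in>space M. \<forall>t\<ge>0. \<forall>k<m. Z' t \<omega> k = sub_vec I (B t \<omega>) k + (\<Sum>j<m. sub_mat I R k j * L' t \<omega> j)"
      by (simp add: sub_vec_def sub_mat_def RQ[unfolded e_def] Z'_def X_def e_def)
  qed (use ad path in auto)
  moreover have "\<forall>k<m. 0 \<le> sub_vec I z k"
    using z e(2) by (simp add: sub_vec_def e_def)
  ultimately have "\<not> (AE \<omega> in M. \<forall>t>0. \<not> (\<forall>k\<in>{0..<m}. Z' t \<omega> k = 0))"
    using assms(6) unfolding srbm_hits_def m_def by blast
  moreover have "AE \<omega> in M. \<forall>t>0. \<not> (\<forall>k\<in>{0..<m}. Z' t \<omega> k = 0)"
    using avoid AE_space
  proof eventually_elim
    case (elim \<omega>)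
    show ?case
    proof (intro allI impI notI)
      fix t :: real assume t: "0 < t" and hit: "\<forall>k\<in>{0..<m}. Z' t \<omega> k = 0"
      have "Z t \<omega> i = 0" if "i \<in> I" for i
      proof -
        have "i \<in> e ` {..<m}" using that by (simp only: bij_betw_imp_surj_on[OF bij])
        then obtain k where k: "k < m" "i = e k" by blast
        \<comment> \<open>Squeezed:
          \<open>0 \<le> Z t \<omega> (e k) \<le> Z' t \<omega> k = 0\<close>.\<close>
        then show ?thesis
          using path(7)[OF elim(2) k(1), of t] Z0[OF elim(2) _ e(2)[OF k(1)], of t] hit t by auto
      qed
      then show False using elim(1) t by blast
    qed
  qed
  ultimately show False by blast
qed

end
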